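(* Let $Q$ be a power of $2$ (with $Q\geq 2$). Then the set of all polynomials $\beta x^{Q^2+Q+2}+\alpha x$ with $\beta\in\mathbb{F}_Q$ and $\alpha\in\mathbb{F}_{Q^3}$ satisfying $\alpha^{Q^2}+\alpha^Q+\alpha=0$, where at least one of $\alpha,\beta$ is nonzero, corresponds to a complete set of $Q^3-1$ mutually orthogonal latin squares of order $Q^3$.
   Context: For a prime power $q$, $\mathbb{F}_q$ denotes the finite field with $q$ elements, and $\mathbb{F}_Q$ is regarded as a subfield of $\mathbb{F}_{Q^3}$. A latin square of order $n$ is an $n\times n$ matrix with entries from an $n$-element set $S$ such that each element of $S$ occurs exactly once in each row and each column. Two latin squares $[\alpha_{ij}]$ and $[\beta_{ij}]$ with the same set $S$ are orthogonal if every ordered pair in $S\times S$ occurs as $(\alpha_{ij},\beta_{ij})$ for some $i,j$. A set of mutually orthogonal latin squares (MOLS) is a set of pairwise orthogonal latin squares; a complete set of MOLS of order $n$ is a set of $n-1$ MOLS of order $n$. Here $S=\mathbb{F}_q$ with $q=Q^3$, rows and columns are labeled by the elements of $\mathbb{F}_q$, and a polynomial $f$ inducing a permutation of $\mathbb{F}_q$ corresponds to the latin square whose $ij$-th entry is $i+f(j)$, for $i,j\in\mathbb{F}_q$. *)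

theory Defs
  imports
    "HOL-Analysis.Finite_Cartesian_Product"
    "HOL-Computational_Algebra.Polynomial"
    "HOL-Algebra.Algebraic_Closure_Type"
begin

text \<open>
  Rows and columns are both labelled by the finite type \<open>'n\<close>, so the order is \<open>CARD('n)\<close>.
  Since this is positive, \<open>card S = CARD('n)\<close> includes that \<open>S\<close> is finite.
\<close>

definition latin_square :: "'s set \<Rightarrow> 's ^ 'n ^ 'n \<Rightarrow> bool" where
  "latin_square S L \<longleftrightarrow>
     card S = CARD('n) \<and>
     (\<forall>i j. L $ i $ j \<in> S) \<and>
     (\<forall>i. \<forall>s\<in>S. \<exists>!j. L $ i $ j = s) \<and>
     (\<forall>j. \<forall>s\<in>S. \<exists>!i. L $ i $ j = s)"

definition orthogonal_squares :: "'s set \<Rightarrow> 's ^ 'n ^ 'n \<Rightarrow> 's ^ 'n ^ 'n \<Rightarrow> bool" where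
  "orthogonal_squares S L M \<longleftrightarrow> (\<forall>(a, b)\<in>S \<times> S. \<exists>i j. (L $ i $ j, M $ i $ j) = (a, b))"

definition mutually_orthogonal :: "'s set \<Rightarrow> ('s ^ 'n ^ 'n) set \<Rightarrow> bool" where
  "mutually_orthogonal S \<M> \<longleftrightarrow>
     (\<forall>L\<in>\<M>. latin_square S L) \<and> pairwise (orthogonal_squares S) \<M>"

definition complete_MOLS :: "nat \<Rightarrow> 's set \<Rightarrow> ('s ^ 'n ^ 'n) set \<Rightarrow> bool" where
  "complete_MOLS n S \<M> \<longleftrightarrow>
     CARD('n) = n \<and> mutually_orthogonal S \<M> \<and> card \<M> = n - 1"

text \<open>
  The square attached to a polynomial is defined for every polynomial, but it is a Latin square
  only if the polynomial induces a permutation.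
\<close>

definition permutation_poly :: "'a::{field,finite} poly \<Rightarrow> bool" where
  "permutation_poly f \<longleftrightarrow> bij (poly f)"

definition poly_square :: "'a::{field,finite} poly \<Rightarrow> (('a, 'a) vec, 'a) vec" where
  "poly_square f = (\<chi> i j. i + poly f j)"

text \<open>
  Here \<open>K\<close> is the subfield with \<open>Q\<close> elements of the field \<open>'a\<close> with \<open>Q ^ 3\<close> elements.
  Members of the family are formal polynomials: for \<open>Q = 2\<close> the first exponent is \<open>Q ^ 3\<close> itself,
  and they are not reduced modulo \<open>x ^ (Q ^ 3) - x\<close>.
\<close>

definition trace_family :: "nat \<Rightarrow> 'a::{field,finite} set \<Rightarrow> 'a poly set" where
  "trace_family Q K =
     {Polynomial.monom \<beta> (Q ^ 2 + Q + 2) + Polynomial.monom \<alpha> 1 | \<alpha> \<beta>.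
        \<beta> \<in> K \<and> \<alpha> ^ (Q ^ 2) + \<alpha> ^ Q + \<alpha> = 0 \<and> (\<alpha> \<noteq> 0 \<or> \<beta> \<noteq> 0)}"

end

theory Submission
  imports Defs "HOL-Number_Theory.Residues"
begin

text \<open>
  Let \<open>N\<close> and \<open>T\<close> be the norm and the trace of the cubic extension. Since \<open>x ^ (Q\<^sup>2 + Q + 2) = x * N x\<close>,
  the polynomials are \<open>x * (\<beta> * N x + \<alpha>)\<close> with \<open>T \<alpha> = 0\<close>. The norm of such a value is \<open>g (N x)\<close> with
  \<open>g t = t * N (\<beta> * t + \<alpha>)\<close> for \<open>t\<close> in \<open>K\<close>. As the trace of \<open>\<alpha>\<close> vanishes, the cubic term of \<open>g\<close>
  disappears, so \<open>g\<close> contains only the powers \<open>t\<^sup>4\<close>, \<open>t\<^sup>2\<close>, \<open>t\<close> and is additive in characteristic 2.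
  A nonzero root of \<open>g\<close> in \<open>K\<close> would put \<open>\<alpha>\<close> into \<open>K\<close>, where the trace is the identity, so \<open>g\<close>
  is injective on \<open>K\<close>; this yields \<open>N x\<close>, and then \<open>x\<close>. Finally, the family together with \<open>0\<close> is an
  additive group, so differences of distinct members are again permutations, which is orthogonality;
  its order is \<open>Q ^ 3\<close> because the field is the direct sum of \<open>K\<close> and the kernel of \<open>T\<close>.
\<close>

section \<open>Finite-field preliminaries\<close>

lemma power_card_eq_self:
  fixes x :: "'a::field"
  assumes fin: "finite K" and mult: "\<And>a b. a \<in> K \<Longrightarrow> b \<in> K \<Longrightarrow> a * b \<in> K"
    and zero: "0 \<in> K" and x: "x \<in> K"
  shows "x ^ card K = x"
proof (cases "x = 0")
  case True
  then show ?thesis using fin zero by (auto simp: zero_power card_gt_0_iff)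
next
  case False
  let ?U = "K - {0}"
  have inj: "inj_on ((*) x) ?U" using False by (auto simp: inj_on_def)
  have "(*) x ` ?U \<subseteq> ?U" using mult x False by auto
  \<comment> \<open>As in Fermat's little theorem: multiplication by \<open>x\<close> permutes
    \<open>?U\<close>, so comparing the products over \<open>?U\<close> gives
    \<open>x ^ card ?U = 1\<close>.\<close>
  then have img: "(*) x ` ?U = ?U" using inj fin by (simp add: endo_inj_surj)
  have "\<Prod>?U = \<Prod>((*) x ` ?U)" by (simp only: img)
  also have "\<dots> = (\<Prod>a\<in>?U. x * a)" using prod.reindex[OF inj, of id] by simp
  also have "\<dots> = x ^ card ?U * \<Prod>?U" by (simp add: prod.distrib)
  finally have "\<Prod>?U = 0 \<or> x ^ card ?U = 1" by (simp only: mult_cancel_right1)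
  moreover have "\<Prod>?U \<noteq> 0" using fin by simp
  ultimately have "x ^ card ?U = 1" by blast
  moreover have "card K = Suc (card ?U)" using fin zero by (rule card.remove)
  ultimately show ?thesis by (simp only: power_Suc mult_1_right)
qed

lemma CHAR_eq_prime:
  assumes "prime p" and "CARD('a::{field,finite}) = p ^ n"
  shows "CHAR('a) = p"
proof -
  have pr: "prime CHAR('a)" by (intro prime_CHAR_semidom finite_imp_CHAR_pos finite)
  have "CHAR('a) dvd p ^ n" using CHAR_dvd_CARD[where ?'a='a] assms(2) by (simp only:)
  then have "CHAR('a) dvd p" by (rule prime_dvd_power[OF pr])
  then show ?thesis by (rule primes_dvd_imp_eq[OF pr assms(1)])
qed

section \<open>Characteristic 2 and the Frobenius map of the extension\<close>

locale cubic_extension_char_2 =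
  fixes Q :: nat and K :: "'a::{field,finite} set"
  assumes Q_power: "\<exists>k\<ge>1. Q = 2 ^ k"
    and card_field: "CARD('a) = Q ^ 3"
    and subfield_K: "subfield K (ring_of_type_algebra :: 'a ring)"
    and card_K: "card K = Q"
begin

lemma Q_ge_2: "Q \<ge> 2"
proof -
  obtain k where "k \<ge> 1" "Q = 2 ^ k" using Q_power by blast
  then show ?thesis using power_increasing[of 1 k "2::nat"] by simp
qed

lemma CHAR_eq_2: "CHAR('a) = 2"
proof -
  obtain k where "Q = 2 ^ k" using Q_power by blast
  then have "CARD('a) = 2 ^ (k * 3)" using card_field by (simp only: power_mult)
  then show ?thesis by (rule CHAR_eq_prime[OF two_is_prime_nat])
qed

lemma add_self [simp]: "x + x = (0::'a)"
proof -
  have "of_nat CHAR('a) = (0::'a)" by (rule of_nat_CHAR)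
  then have "(2::'a) = 0" by (simp only: CHAR_eq_2 of_nat_numeral)
  then show ?thesis by (simp only: mult_2[symmetric] mult_zero_left)
qed

lemma minus_eq_add: "x - y = x + (y::'a)"
  unfolding diff_eq_eq by (simp only: add.assoc add_self add_0_right)

lemma eq_iff_add_eq_0: "x = y \<longleftrightarrow> x + y = (0::'a)"
  unfolding minus_eq_add[symmetric] by (rule eq_iff_diff_eq_0)

lemma add_power_Q: "(x + y) ^ Q = x ^ Q + (y::'a) ^ Q"
proof -
  obtain k where "Q = 2 ^ k" using Q_power by auto
  then show ?thesis
    by (intro freshmans_dream'[where n = k]) (simp_all only: CHAR_eq_2 two_is_prime_nat)
qed

lemma power_Q_Q: "((x::'a) ^ Q) ^ Q = x ^ (Q ^ 2)"
  by (metis power2_eq_square power_mult)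

lemma add_power_Q_sq: "(x + y) ^ (Q ^ 2) = x ^ (Q ^ 2) + (y::'a) ^ (Q ^ 2)"
  by (simp only: add_power_Q power_Q_Q[symmetric])

lemma add_power_2: "(x + y) ^ 2 = x ^ 2 + (y::'a) ^ 2"
  by (rule freshmans_dream) (simp_all only: CHAR_eq_2 two_is_prime_nat)

lemma power_Q_cubed: "(x::'a) ^ (Q ^ 3) = x"
  unfolding card_field[symmetric] by (rule power_card_eq_self) auto

lemma power_Q_sq_Q: "((x::'a) ^ (Q ^ 2)) ^ Q = x"
proof -
  have "Q ^ 2 * Q = Q ^ 3" by (simp only: power2_eq_square power3_eq_cube)
  then show ?thesis by (simp only: power_mult[symmetric] power_Q_cubed)
qed

lemma K_closed:
  "0 \<in> K" "a \<in> K \<Longrightarrow> b \<in> K \<Longrightarrow> a + b \<in> K" "a \<in> K \<Longrightarrow> b \<in> K \<Longrightarrow> a * b \<in> K"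
proof -
  note sr = subfieldE(1)[OF subfield_K]
  show "0 \<in> K" using subringE(2)[OF sr] by (simp add: ring_of_type_algebra_def)
  show "a \<in> K \<Longrightarrow> b \<in> K \<Longrightarrow> a + b \<in> K"
    using subringE(7)[OF sr, of a b] by (simp add: ring_of_type_algebra_def)
  show "a \<in> K \<Longrightarrow> b \<in> K \<Longrightarrow> a * b \<in> K"
    using subringE(6)[OF sr, of a b] by (simp add: ring_of_type_algebra_def)
qed

text \<open>The elements of \<open>K\<close> are roots of X^Q - X, and since this polynomial has at
  most Q = \<open>card K\<close> roots, there are no others. Membership in \<open>K\<close> thereby
  becomes an equation that rewriting can check.\<close>

lemma K_iff: "x \<in> K \<longleftrightarrow> x ^ Q = x"
proof -
  let ?p = "Polynomial.monom (1::'a) Q - Polynomial.monom 1 1"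
  have coeff: "poly.coeff ?p Q = 1" using Q_ge_2 by simp
  then have "?p \<noteq> 0" by (metis coeff_0 zero_neq_one)
  then have "card {x. poly ?p x = 0} \<le> degree ?p" by (rule card_poly_roots_bound)
  also have "\<dots> \<le> Q" using Q_ge_2 by (intro degree_diff_le degree_monom_le[THEN order_trans]) auto
  finally have le: "card {x::'a. x ^ Q = x} \<le> card K" by (simp add: poly_monom card_K)
  have "x ^ Q = x" if "x \<in> K" for x
    using power_card_eq_self[of K x] K_closed that by (simp add: card_K)
  then have "K \<subseteq> {x. x ^ Q = x}" by blast
  then have "K = {x. x ^ Q = x}" using le by (rule card_seteq[OF finite])
  then show ?thesis by (rule arg_cong[where f = "\<lambda>A. x \<in> A", THEN trans]) simp
qed

lemma K_power_Q_sq: "x \<in> K \<Longrightarrow> x ^ (Q ^ 2) = x"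
  by (simp only: K_iff power_Q_Q[symmetric])

section \<open>Norm and trace down to K\<close>

definition norm3 :: "'a \<Rightarrow> 'a" where
  "norm3 x = x * x ^ Q * x ^ (Q ^ 2)"

definition trace3 :: "'a \<Rightarrow> 'a" where
  "trace3 x = x ^ (Q ^ 2) + x ^ Q + x"

text \<open>Raising to the power \<open>Q\<close> permutes the three conjugates cyclically, so their
  product is fixed.\<close>

lemma norm3_in_K: "norm3 x \<in> K"
  by (simp only: K_iff norm3_def power_mult_distrib power_Q_Q power_Q_sq_Q mult_ac)

lemma norm3_mult: "norm3 (x * y) = norm3 x * norm3 y"
  by (simp only: norm3_def power_mult_distrib mult_ac)

lemma norm3_eq_0_iff [simp]: "norm3 x = 0 \<longleftrightarrow> x = 0"
  by (auto simp: norm3_def zero_power)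

lemma trace3_in_K: "trace3 x \<in> K"
  by (simp only: K_iff trace3_def add_power_Q power_Q_Q power_Q_sq_Q add_ac)

lemma trace3_add: "trace3 (x + y) = trace3 x + trace3 y"
  by (simp only: trace3_def add_power_Q add_power_Q_sq add_ac)

lemma trace3_of_K: "x \<in> K \<Longrightarrow> trace3 x = x"
  by (simp add: trace3_def K_power_Q_sq K_iff[THEN iffD1])

text \<open>In characteristic 2 the last assumption says \<alpha> = u, so \<alpha> lies in
  \<open>K\<close> and equals its own trace.\<close>

lemma trace3_eq_0_add_K:
  assumes "trace3 \<alpha> = 0" "u \<in> K" "u + \<alpha> = 0"
  shows "\<alpha> = 0"
  using assms trace3_of_K eq_iff_add_eq_0 by metis

text \<open>Frobenius fixes \<open>u\<close>, so the norm is the product of \<open>u\<close> plus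
  each conjugate of \<alpha>; the coefficients are the elementary symmetric functions of the
  conjugates.\<close>

lemma norm3_K_add:
  assumes "u \<in> K"
  shows "norm3 (u + \<alpha>) = u ^ 3 + trace3 \<alpha> * u ^ 2
    + (\<alpha> * \<alpha> ^ Q + \<alpha> * \<alpha> ^ (Q ^ 2) + \<alpha> ^ Q * \<alpha> ^ (Q ^ 2)) * u + norm3 \<alpha>"
proof -
  have "norm3 (u + \<alpha>) = (u + \<alpha>) * (u + \<alpha> ^ Q) * (u + \<alpha> ^ (Q ^ 2))"
    using assms by (simp add: norm3_def add_power_Q add_power_Q_sq K_power_Q_sq K_closed K_iff[THEN iffD1])
  moreover have "(u + a) * (u + b) * (u + c) =
      u ^ 3 + (c + b + a) * u ^ 2 + (a * b + a * c + b * c) * u + a * b * c" for a b c :: 'a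
    by (simp add: power2_eq_square power3_eq_cube algebra_simps)
  ultimately show ?thesis
    by (simp only: norm3_def trace3_def)
qed

section \<open>Injectivity of the induced maps\<close>

lemma mult_norm3_additive:
  assumes "\<beta> \<in> K" "trace3 \<alpha> = 0" "s \<in> K" "t \<in> K"
  shows "(s + t) * norm3 (\<beta> * (s + t) + \<alpha>) = s * norm3 (\<beta> * s + \<alpha>) + t * norm3 (\<beta> * t + \<alpha>)"
proof -
  define e2 where "e2 = \<alpha> * \<alpha> ^ Q + \<alpha> * \<alpha> ^ (Q ^ 2) + \<alpha> ^ Q * \<alpha> ^ (Q ^ 2)"
  \<comment> \<open>The fourth power is written as an iterated square so that
    \<open>add_power_2\<close> applies to it twice.\<close>
  have *: "u * norm3 (\<beta> * u + \<alpha>) = \<beta> ^ 3 * (u ^ 2) ^ 2 + \<beta> * e2 * u ^ 2 + norm3 \<alpha> * u"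
    if "u \<in> K" for u
    unfolding norm3_K_add[OF K_closed(3)[OF assms(1) that]] assms(2) e2_def[symmetric]
    by (simp add: power2_eq_square power3_eq_cube algebra_simps)
  show ?thesis
    unfolding *[OF assms(3)] *[OF assms(4)] *[OF K_closed(2)[OF assms(3,4)]] add_power_2
    by (simp add: algebra_simps)
qed

lemma inj_mult_norm3_add:
  assumes \<beta>: "\<beta> \<in> K" and \<alpha>: "trace3 \<alpha> = 0" and nz: "\<alpha> \<noteq> 0 \<or> \<beta> \<noteq> 0"
  shows "inj (\<lambda>x. x * (\<beta> * norm3 x + \<alpha>))"
proof (rule injI)
  fix x y
  assume eq: "x * (\<beta> * norm3 x + \<alpha>) = y * (\<beta> * norm3 y + \<alpha>)"
  \<comment> \<open>The trace condition forces \<alpha> = 0; then \<beta> is nonzero and \<beta> * t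
    = 0 leaves t = 0.\<close>
  have root: "t = 0" if t: "t \<in> K" and "\<beta> * t + \<alpha> = 0" for t
    using trace3_eq_0_add_K[OF \<alpha> K_closed(3)[OF \<beta> t]] that nz by auto
  \<comment> \<open>This sum is also the difference of the norms, so additivity will turn the
    equality of norms of the two values into a zero at \<open>s\<close>.\<close>
  define s where "s = norm3 x + norm3 y"
  have s: "s \<in> K" unfolding s_def by (intro K_closed norm3_in_K)
  have "norm3 x * norm3 (\<beta> * norm3 x + \<alpha>) = norm3 y * norm3 (\<beta> * norm3 y + \<alpha>)"
    using arg_cong[OF eq, of norm3] by (simp only: norm3_mult)
  then have "s * norm3 (\<beta> * s + \<alpha>) = 0"
    unfolding s_def using mult_norm3_additive[OF \<beta> \<alpha> norm3_in_K norm3_in_K, of x y] by simp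
  then have "s = 0" using root[OF s] by auto
  then have N: "norm3 x = norm3 y" unfolding s_def eq_iff_add_eq_0[of "norm3 x"] .
  show "x = y"
  \<comment> \<open>The common factor cancels unless it vanishes; in that case both norms, hence
    both arguments, are 0.\<close>
  proof (cases "\<beta> * norm3 y + \<alpha> = 0")
    case True
    then have "norm3 y = 0" using root norm3_in_K by blast
    with N show ?thesis by simp
  next
    case False
    with eq N show ?thesis by simp
  qed
qed

section \<open>The family as formal polynomials, and its size\<close>

definition family_poly :: "'a \<Rightarrow> 'a \<Rightarrow> 'a poly" where
  "family_poly \<alpha> \<beta> = Polynomial.monom \<beta> (Q ^ 2 + Q + 2) + Polynomial.monom \<alpha> 1"

lemma poly_family_poly: "poly (family_poly \<alpha> \<beta>) x = x * (\<beta> * norm3 x + \<alpha>)"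
  by (simp add: family_poly_def poly_monom norm3_def power_add power2_eq_square[of x] algebra_simps)

lemma family_poly_diff:
  "family_poly \<alpha> \<beta> - family_poly \<alpha>' \<beta>' = family_poly (\<alpha> - \<alpha>') (\<beta> - \<beta>')"
  by (simp only: family_poly_def add_diff_add flip: diff_monom)

lemma family_poly_eq_0_iff: "family_poly \<alpha> \<beta> = 0 \<longleftrightarrow> \<alpha> = 0 \<and> \<beta> = 0"
proof
  assume 0: "family_poly \<alpha> \<beta> = 0"
  have "\<alpha> = poly.coeff (family_poly \<alpha> \<beta>) 1"
    "\<beta> = poly.coeff (family_poly \<alpha> \<beta>) (Q ^ 2 + Q + 2)"
    using Q_ge_2 by (simp_all add: family_poly_def)
  then show "\<alpha> = 0 \<and> \<beta> = 0" unfolding 0 coeff_0 by blast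
qed (simp add: family_poly_def)

lemma inj_family_poly: "inj (\<lambda>(\<alpha>, \<beta>). family_poly \<alpha> \<beta>)"
proof (rule injI, clarify)
  fix \<alpha> \<beta> \<alpha>' \<beta>'
  assume "family_poly \<alpha> \<beta> = family_poly \<alpha>' \<beta>'"
  then have "family_poly (\<alpha> - \<alpha>') (\<beta> - \<beta>') = 0" by (simp flip: family_poly_diff)
  then show "\<alpha> = \<alpha>' \<and> \<beta> = \<beta>'" by (simp add: family_poly_eq_0_iff)
qed

lemma trace_family_eq:
  "trace_family Q K =
    {family_poly \<alpha> \<beta> | \<alpha> \<beta>. \<beta> \<in> K \<and> trace3 \<alpha> = 0 \<and> (\<alpha> \<noteq> 0 \<or> \<beta> \<noteq> 0)}"
  by (simp only: trace_family_def family_poly_def trace3_def)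

text \<open>Adjoining 0 removes the nonvanishing condition, leaving a parameter set that is closed
  under addition and is a product, as needed for differences and for counting.\<close>

lemma insert_0_trace_family:
  "insert 0 (trace_family Q K) = {family_poly \<alpha> \<beta> | \<alpha> \<beta>. \<beta> \<in> K \<and> trace3 \<alpha> = 0}"
proof -
  have "family_poly 0 0 = 0" by (simp add: family_poly_eq_0_iff)
  moreover have "trace3 0 = 0" using trace3_of_K K_closed(1) by blast
  ultimately show ?thesis
    unfolding trace_family_eq set_eq_iff insert_iff mem_Collect_eq using K_closed(1) by metis
qed

lemma zero_notin_trace_family: "0 \<notin> trace_family Q K"
proof
  assume "0 \<in> trace_family Q K"
  then obtain \<alpha> \<beta> where "\<alpha> \<noteq> 0 \<or> \<beta> \<noteq> 0" "family_poly \<alpha> \<beta> = 0"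
    unfolding trace_family_eq mem_Collect_eq by metis
  then show False by (simp add: family_poly_eq_0_iff)
qed

lemma trace_family_diff:
  assumes "f \<in> trace_family Q K" "g \<in> trace_family Q K" "f \<noteq> g"
  shows "f - g \<in> trace_family Q K"
proof -
  obtain \<alpha> \<beta> where f: "f = family_poly \<alpha> \<beta>" "trace3 \<alpha> = 0" "\<beta> \<in> K"
    using assms(1) unfolding trace_family_eq by blast
  obtain \<alpha>' \<beta>' where g: "g = family_poly \<alpha>' \<beta>'" "trace3 \<alpha>' = 0" "\<beta>' \<in> K"
    using assms(2) unfolding trace_family_eq by blast
  have "f - g = family_poly (\<alpha> + \<alpha>') (\<beta> + \<beta>')"
    unfolding f g family_poly_diff minus_eq_add ..
  moreover have "trace3 (\<alpha> + \<alpha>') = 0" by (simp add: trace3_add f g)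
  moreover have "\<beta> + \<beta>' \<in> K" using f g K_closed by blast
  ultimately have "f - g \<in> insert 0 (trace_family Q K)"
    unfolding insert_0_trace_family by blast
  with assms(3) show ?thesis by simp
qed

lemma card_trace_family: "card (trace_family Q K) = Q ^ 3 - 1"
proof -
  let ?A = "{\<alpha>. trace3 \<alpha> = 0} \<times> K"
  have image: "insert 0 (trace_family Q K) = (\<lambda>(\<alpha>, \<beta>). family_poly \<alpha> \<beta>) ` ?A"
    unfolding insert_0_trace_family by auto
  then have fin: "finite (trace_family Q K)" by (metis finite finite_imageI finite_insert)
  have "card (insert 0 (trace_family Q K)) = card ?A"
    unfolding image by (rule card_image[OF inj_on_subset[OF inj_family_poly subset_UNIV]])
  also have "\<dots> = CARD('a)"
  proof (rule bij_betw_same_card)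
    show "bij_betw (\<lambda>(\<alpha>, \<beta>). \<alpha> + \<beta>) ?A UNIV"
    \<comment> \<open>The witness splits z as (z + T z) + T z, with T the trace: T is the identity
      on \<open>K\<close>, so the first summand has trace T z + T z = 0.\<close>
    proof (rule bij_betw_byWitness[where f' = "\<lambda>z. (z + trace3 z, trace3 z)"])
      show "\<forall>p\<in>?A. (\<lambda>z. (z + trace3 z, trace3 z)) ((\<lambda>(\<alpha>, \<beta>). \<alpha> + \<beta>) p) = p"
        by (auto simp: trace3_add trace3_of_K add.assoc)
      show "\<forall>z\<in>UNIV. (\<lambda>(\<alpha>, \<beta>). \<alpha> + \<beta>) (z + trace3 z, trace3 z) = z"
        by (simp add: add.assoc)
      show "(\<lambda>z. (z + trace3 z, trace3 z)) ` UNIV \<subseteq> ?A"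
        by (auto simp: trace3_add trace3_of_K trace3_in_K)
    qed auto
  qed
  finally have "Suc (card (trace_family Q K)) = Q ^ 3"
    using fin zero_notin_trace_family by (simp add: card_field)
  then show ?thesis by simp
qed

lemma permutation_poly_trace_family:
  assumes "f \<in> trace_family Q K"
  shows "permutation_poly f"
proof -
  obtain \<alpha> \<beta> where f: "f = family_poly \<alpha> \<beta>"
    and \<beta>: "\<beta> \<in> K" and \<alpha>: "trace3 \<alpha> = 0" and nz: "\<alpha> \<noteq> 0 \<or> \<beta> \<noteq> 0"
    using assms unfolding trace_family_eq by blast
  have "poly f = (\<lambda>x. x * (\<beta> * norm3 x + \<alpha>))"
    unfolding f poly_family_poly ..
  then have "inj (poly f)" using inj_mult_norm3_add[OF \<beta> \<alpha> nz] by simp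
  then show ?thesis by (simp add: permutation_poly_def bij_def finite_UNIV_inj_surj)
qed

end

section \<open>Latin squares from permutation polynomials\<close>

lemma latin_square_poly_square:
  assumes "permutation_poly f"
  shows "latin_square UNIV (poly_square f)"
proof -
  have "\<forall>y. \<exists>!j. poly f j = y"
    using assms unfolding permutation_poly_def bij_iff .
  then have "\<exists>!j. poly f j = s - i" for s i by (rule spec)
  then have "\<exists>!j. i + poly f j = s" for s i
    by (simp only: eq_diff_eq add.commute[of i])
  \<comment> \<open>Each column is a translate of the identity, whatever \<open>f\<close> is; only
    the rows use bijectivity.\<close>
  moreover have "\<exists>!i. i + poly f j = s" for s j
    by (rule ex1I[of _ "s - poly f j"]) (simp_all add: eq_diff_eq)
  ultimately show ?thesis by (simp add: latin_square_def poly_square_def)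
qed

text \<open>Subtracting i + g(j) = b from i + f(j) = a eliminates i: the permutation
  \<open>f - g\<close> supplies j, and then i = a - f(j).\<close>

lemma orthogonal_poly_square:
  assumes "permutation_poly (f - g)"
  shows "orthogonal_squares UNIV (poly_square f) (poly_square g)"
  unfolding orthogonal_squares_def
proof clarify
  fix a b :: 'a
  obtain j where j: "poly (f - g) j = a - b"
    using assms unfolding permutation_poly_def by (metis bij_pointE)
  have "(poly_square f $ (a - poly f j) $ j, poly_square g $ (a - poly f j) $ j) = (a, b)"
    using j by (simp add: poly_square_def algebra_simps)
  then show "\<exists>i j. (poly_square f $ i $ j, poly_square g $ i $ j) = (a, b)" by blast
qed

lemma poly_square_neq:
  assumes "permutation_poly (f - g)"
  shows "poly_square f \<noteq> poly_square g"
proof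
  assume "poly_square f = poly_square g"
  then have "poly (f - g) x = 0" for x
    by (simp add: poly_square_def vec_eq_iff)
  with assms have "(0::'a) = 1"
    unfolding permutation_poly_def bij_def by (metis injD)
  then show False by simp
qed

theorem corollary4p2:
  fixes Q :: nat and K :: "'a::{field,finite} set"
  assumes "\<exists>k\<ge>1. Q = 2 ^ k"
    and "CARD('a) = Q ^ 3"
    and "subfield K (ring_of_type_algebra :: 'a ring)"
    and "card K = Q"
  shows "(\<forall>f\<in>trace_family Q K. permutation_poly f) \<and>
         inj_on poly_square (trace_family Q K) \<and>
         card (trace_family Q K) = Q ^ 3 - 1 \<and>
         complete_MOLS (Q ^ 3) (UNIV :: 'a set) (poly_square ` trace_family Q K)"
proof -
  interpret cubic_extension_char_2 Q K
    by (rule cubic_extension_char_2.intro[OF assms])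
  have diff: "permutation_poly (f - g)"
    if "f \<in> trace_family Q K" "g \<in> trace_family Q K" "f \<noteq> g" for f g
    using permutation_poly_trace_family trace_family_diff that by blast
  \<comment> \<open>Distinct polynomials give distinct squares, which carries the count of the
    family over to the set of squares.\<close>
  have inj: "inj_on poly_square (trace_family Q K)"
    using diff poly_square_neq by (meson inj_onI)
  have "mutually_orthogonal UNIV (poly_square ` trace_family Q K)"
    unfolding mutually_orthogonal_def pairwise_def
    using permutation_poly_trace_family diff latin_square_poly_square orthogonal_poly_square
    by blast
  then show ?thesis
    using inj permutation_poly_trace_family card_trace_family assms(2)
    by (simp add: complete_MOLS_def card_image)
qed

end
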